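(* Let $\mathsf{A}\in\mathbb{R}^{J_1\times J_1\times\cdots\times J_N\times J_N}$ and let $\tilde{\mathsf{A}}\in\mathbb{R}^{J_1\times\cdots\times J_N\times J_1\times\cdots\times J_N}$ be given by $\tilde{\mathsf{A}}_{j_1\cdots j_Ni_1\cdots i_N}=\mathsf{A}_{j_1i_1\cdots j_Ni_N}$. Suppose that a tensor train decomposition of $\tilde{\mathsf{A}}$ with TT-ranks $R_0,\dots,R_{2N}$ and core tensors $\tilde{\mathsf{A}}^{(1)},\dots,\tilde{\mathsf{A}}^{(2N)}$ is given in which the first $N-1$ core tensors are left-orthonormal and the last $N$ core tensors are right-orthonormal. Consider the unforced multilinear time-invariant system $\mathsf{X}_{t+1}=\mathsf{A}*\mathsf{X}_t$, $\mathsf{X}_t\in\mathbb{R}^{J_1\times\cdots\times J_N}$. If the largest singular value of the matrix $\bar{\tilde{\mathbf{A}}}^{(N)}=\texttt{reshape}(\tilde{\mathsf{A}}^{(N)},R_{N-1}J_N,R_N)$ is less than one, then the equilibrium point $\mathsf{X}=\mathsf{O}$ is asymptotically stable.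
   Context: The Einstein product is $(\mathsf{A}*\mathsf{X})_{j_1\cdots j_N}=\sum_{i_1}\cdots\sum_{i_N}\mathsf{A}_{j_1i_1\cdots j_Ni_N}\mathsf{X}_{i_1\cdots i_N}$. $\|\cdot\|$ is the Frobenius norm and $\mathsf{O}$ the zero tensor. The equilibrium $\mathsf{X}=\mathsf{O}$ is asymptotically stable if $\|\mathsf{X}_t\|\to0$ as $t\to\infty$ for every initial condition $\mathsf{X}_0$. A tensor train decomposition of $\mathsf{Y}\in\mathbb{R}^{L_1\times\cdots\times L_M}$ is an expression $\mathsf{Y}_{l_1\cdots l_M}=\sum_{r_0=1}^{R_0}\cdots\sum_{r_M=1}^{R_M}\mathsf{Y}^{(1)}_{r_0l_1r_1}\mathsf{Y}^{(2)}_{r_1l_2r_2}\cdots\mathsf{Y}^{(M)}_{r_{M-1}l_Mr_M}$ with core tensors $\mathsf{Y}^{(n)}\in\mathbb{R}^{R_{n-1}\times L_n\times R_n}$ and $R_0=R_M=1$. Here $M=2N$ and $L_n=L_{N+n}=J_n$ for $n=1,\dots,N$. For a core tensor $\mathsf{Y}^{(n)}$ let $\bar{\mathbf{Y}}^{(n)}=\texttt{reshape}(\mathsf{Y}^{(n)},R_{n-1}L_n,R_n)$ (rows indexed by $(r_{n-1},l_n)$, columns by $r_n$) and $\underline{\mathbf{Y}}^{(n)}=\texttt{reshape}(\mathsf{Y}^{(n)},R_{n-1},L_nR_n)$ (rows indexed by $r_{n-1}$, columns by $(l_n,r_n)$), with first index varying fastest in each pair. The core is left-orthonormal if $(\bar{\mathbf{Y}}^{(n)})^\top\bar{\mathbf{Y}}^{(n)}=\mathbf{I}$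 and right-orthonormal if $\underline{\mathbf{Y}}^{(n)}(\underline{\mathbf{Y}}^{(n)})^\top=\mathbf{I}$. *)

theory Defs
  imports "Jordan_Normal_Form.Spectral_Radius"
begin

text \<open>A real tensor of size \<open>L\<^sub>1 \<times> \<dots> \<times> L\<^sub>M\<close> is a function on multi-indices
  \<open>[l\<^sub>1, \<dots>, l\<^sub>M]\<close>, extended by zero outside the index range, so that equality of functions is
  equality of tensors. Index values start at 0; modes and cores are numbered from 1, so mode \<open>n\<close> of
  a list of sizes or indices is its entry \<open>n - 1\<close>.\<close>

definition multi_indices :: "nat list \<Rightarrow> nat list set" where
  "multi_indices Ls = {ls. length ls = length Ls \<and> (\<forall>k<length Ls. ls ! k < Ls ! k)}"

type_synonym tensor = "nat list \<Rightarrow> real"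

definition tensors :: "nat list \<Rightarrow> tensor set" where
  "tensors Ls = {Y. \<forall>ls. ls \<notin> multi_indices Ls \<longrightarrow> Y ls = 0}"

definition frobenius_norm :: "nat list \<Rightarrow> tensor \<Rightarrow> real" where
  "frobenius_norm Ls Y = sqrt (\<Sum>ls\<in>multi_indices Ls. (Y ls)\<^sup>2)"

text \<open>\<open>splice [j\<^sub>1, \<dots>, j\<^sub>N] [i\<^sub>1, \<dots>, i\<^sub>N] = [j\<^sub>1, i\<^sub>1, \<dots>, j\<^sub>N, i\<^sub>N]\<close> gives the paired
  index order of an even-order tensor in \<open>tensors (splice Js Js)\<close>.\<close>

definition einstein_product :: "nat list \<Rightarrow> tensor \<Rightarrow> tensor \<Rightarrow> tensor" where
  "einstein_product Js A X =
     (\<lambda>js. if js \<in> multi_indices Js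
            then \<Sum>is\<in>multi_indices Js. A (splice js is) * X is else 0)"

definition mlti_asymptotically_stable :: "nat list \<Rightarrow> tensor \<Rightarrow> bool" where
  "mlti_asymptotically_stable Js A \<longleftrightarrow>
     (\<forall>X. X 0 \<in> tensors Js \<and> (\<forall>t. X (Suc t) = einstein_product Js A (X t)) \<longrightarrow>
       ((\<lambda>t. frobenius_norm Js (X t)) \<longlongrightarrow> 0) sequentially)"

definition permuted_tensor :: "nat list \<Rightarrow> tensor \<Rightarrow> tensor" where
  "permuted_tensor Js A =
     (\<lambda>ks. if ks \<in> multi_indices (Js @ Js)
            then A (splice (take (length Js) ks) (drop (length Js) ks)) else 0)"

text \<open>\<open>R n\<close> for \<open>n = 0, \<dots>, M\<close> are the TT-ranks and \<open>G n\<close> for \<open>n = 1, \<dots>, M\<close> the core tensors.\<close>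

definition tt_decomposition ::
  "nat list \<Rightarrow> (nat \<Rightarrow> nat) \<Rightarrow> (nat \<Rightarrow> tensor) \<Rightarrow> tensor \<Rightarrow> bool" where
  "tt_decomposition Ls R G Y \<longleftrightarrow>
     (let M = length Ls in
       R 0 = 1 \<and> R M = 1 \<and> (\<forall>n\<le>M. 1 \<le> R n) \<and>
       (\<forall>n\<in>{1..M}. G n \<in> tensors [R (n - 1), Ls ! (n - 1), R n]) \<and>
       (\<forall>ls\<in>multi_indices Ls.
          Y ls = (\<Sum>rs\<in>multi_indices (map R [0..<Suc M]).
                    \<Prod>n=1..M. G n [rs ! (n - 1), ls ! (n - 1), rs ! n])))"

text \<open>The two reshapes of a tensor of size \<open>p \<times> q \<times> s\<close>, with the first index of a merged pair
  varying fastest.\<close>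

definition left_unfolding :: "nat \<Rightarrow> nat \<Rightarrow> nat \<Rightarrow> tensor \<Rightarrow> real mat" where
  "left_unfolding p q s Y = mat (p * q) s (\<lambda>(k, c). Y [k mod p, k div p, c])"

definition right_unfolding :: "nat \<Rightarrow> nat \<Rightarrow> nat \<Rightarrow> tensor \<Rightarrow> real mat" where
  "right_unfolding p q s Y = mat p (q * s) (\<lambda>(a, k). Y [a, k mod q, k div q])"

definition left_orthonormal :: "nat \<Rightarrow> nat \<Rightarrow> nat \<Rightarrow> tensor \<Rightarrow> bool" where
  "left_orthonormal p q s Y \<longleftrightarrow>
     transpose_mat (left_unfolding p q s Y) * left_unfolding p q s Y = 1\<^sub>m s"

definition right_orthonormal :: "nat \<Rightarrow> nat \<Rightarrow> nat \<Rightarrow> tensor \<Rightarrow> bool" where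
  "right_orthonormal p q s Y \<longleftrightarrow>
     right_unfolding p q s Y * transpose_mat (right_unfolding p q s Y) = 1\<^sub>m p"

text \<open>The singular values of \<open>B\<close> are the square roots of the eigenvalues of \<open>B\<^sup>T B\<close>. If \<open>B\<close> has
  more columns than rows, this set may contain an additional 0, which does not affect the maximum.
  The maximum is meaningful only for a matrix with at least one row and one column.\<close>

definition largest_singular_value :: "real mat \<Rightarrow> real" where
  "largest_singular_value B = Max (sqrt ` spectrum (transpose_mat B * B))"

end

theory Submission
  imports Defs
begin

text \<open>Cut the train at the bond \<open>N\<close>. Because the last \<open>N\<close> cores are right-orthonormal, contracting
  \<open>X\<close> with them core by core yields a vector \<open>y\<close> with \<open>\<parallel>y\<parallel> \<le> \<parallel>X\<parallel>\<close> (Bessel's inequality). Applying the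
  \<open>N\<close>-th core multiplies the norm by at most its largest singular value \<open>\<sigma> < 1\<close>, and the remaining
  left-orthonormal cores act as isometries. Hence \<open>\<parallel>A * X\<parallel> \<le> \<sigma> \<parallel>X\<parallel>\<close>, and the norms decay
  geometrically.\<close>

section \<open>Scalar products and matrix-vector products over the reals\<close>

lemma scalar_prod_self_eq_sum:
  fixes x :: "real vec"
  shows "x \<bullet> x = (\<Sum>i<dim_vec x. (x $ i)\<^sup>2)"
  by (simp add: scalar_prod_def power2_eq_square atLeast0LessThan)

lemma scalar_prod_self_vec:
  fixes z :: "nat \<Rightarrow> real"
  shows "vec n z \<bullet> vec n z = (\<Sum>i<n. (z i)\<^sup>2)"
  by (simp add: scalar_prod_self_eq_sum)

lemma scalar_prod_self_nonneg: "0 \<le> (x :: real vec) \<bullet> x"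
  by (simp add: scalar_prod_self_eq_sum sum_nonneg)

lemma scalar_prod_self_pos:
  fixes x :: "real vec"
  assumes "x \<in> carrier_vec n" and "x \<noteq> 0\<^sub>v n"
  shows "0 < x \<bullet> x"
proof -
  obtain i where "i < n" "x $ i \<noteq> 0"
    using assms by (metis carrier_vecD eq_vecI index_zero_vec)
  then show ?thesis
    unfolding scalar_prod_self_eq_sum using assms by (intro sum_pos2[of _ i]) auto
qed

lemma scalar_prod_mult_mat_vec_self:
  fixes B :: "real mat"
  assumes B: "B \<in> carrier_mat m n" and x: "x \<in> carrier_vec n"
  shows "(B *\<^sub>v x) \<bullet> (B *\<^sub>v x) = x \<bullet> (transpose_mat B * B *\<^sub>v x)"
proof -
  have "(B *\<^sub>v x) \<bullet> (B *\<^sub>v x) = (transpose_mat B *\<^sub>v (B *\<^sub>v x)) \<bullet> x"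
    using transpose_vec_mult_scalar[OF B x, of "B *\<^sub>v x"] B x by simp
  also have "\<dots> = x \<bullet> (transpose_mat B *\<^sub>v (B *\<^sub>v x))"
    using B x by (intro comm_scalar_prod[of _ n]) auto
  also have "transpose_mat B *\<^sub>v (B *\<^sub>v x) = transpose_mat B * B *\<^sub>v x"
    using B x by (intro assoc_mult_mat_vec[symmetric, of _ n m _ n]) auto
  finally show ?thesis .
qed

text \<open>For \<open>y\<close> nonzero, \<open>z\<close> is \<open>y \<bullet> y\<close> times the
  component of \<open>x\<close> orthogonal to \<open>y\<close>. Hence \<open>z \<bullet> z\<close>
  is \<open>y \<bullet> y\<close> times the difference of the two sides, and it is
  nonnegative.\<close>

lemma Cauchy_Schwarz_scalar_prod:
  fixes x y :: "real vec"
  assumes x: "x \<in> carrier_vec n" and y: "y \<in> carrier_vec n"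
  shows "(x \<bullet> y)\<^sup>2 \<le> (x \<bullet> x) * (y \<bullet> y)"
proof (cases "y = 0\<^sub>v n")
  case False
  define z where "z = (y \<bullet> y) \<cdot>\<^sub>v x - (x \<bullet> y) \<cdot>\<^sub>v y"
  have z: "z \<in> carrier_vec n" using x y by (simp add: z_def)
  have zv: "z \<bullet> v = (y \<bullet> y) * (x \<bullet> v) - (x \<bullet> y) * (y \<bullet> v)" if "v \<in> carrier_vec n" for v
    unfolding z_def using x y that by (subst minus_scalar_prod_distrib[of _ n]) auto
  have "z \<bullet> y = 0" using zv[OF y] by simp
  moreover have "z \<bullet> z = (y \<bullet> y) * (z \<bullet> x) - (x \<bullet> y) * (z \<bullet> y)"
    using zv[OF z] comm_scalar_prod[OF x z] comm_scalar_prod[OF y z] by simp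
  ultimately have "z \<bullet> z = (y \<bullet> y) * ((y \<bullet> y) * (x \<bullet> x) - (x \<bullet> y)\<^sup>2)"
    using zv[OF x] comm_scalar_prod[OF x y] by (simp add: power2_eq_square)
  then have "0 \<le> (y \<bullet> y) * ((y \<bullet> y) * (x \<bullet> x) - (x \<bullet> y)\<^sup>2)"
    using scalar_prod_self_nonneg[of z] by simp
  then show ?thesis
    using scalar_prod_self_pos[OF y False] by (simp add: zero_le_mult_iff mult.commute)
qed (use x in simp)

text \<open>Cauchy-Schwarz on each row gives the squared Frobenius norm as a constant. This crude
  bound makes suprema finite and controls inverse matrices.\<close>

lemma mult_mat_vec_bounded:
  fixes C :: "real mat"
  assumes C: "C \<in> carrier_mat m n"
  shows "\<exists>K\<ge>0. \<forall>x\<in>carrier_vec n. (C *\<^sub>v x) \<bullet> (C *\<^sub>v x) \<le> K * (x \<bullet> x)"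
proof (intro exI conjI ballI)
  show "0 \<le> (\<Sum>i<m. row C i \<bullet> row C i)" by (intro sum_nonneg scalar_prod_self_nonneg)
next
  fix x :: "real vec" assume x: "x \<in> carrier_vec n"
  have "(C *\<^sub>v x) \<bullet> (C *\<^sub>v x) = (\<Sum>i<m. (row C i \<bullet> x)\<^sup>2)"
    using C by (simp add: scalar_prod_self_eq_sum)
  also have "\<dots> \<le> (\<Sum>i<m. (row C i \<bullet> row C i) * (x \<bullet> x))"
  proof (rule sum_mono)
    fix i
    show "(row C i \<bullet> x)\<^sup>2 \<le> (row C i \<bullet> row C i) * (x \<bullet> x)"
      using C x by (intro Cauchy_Schwarz_scalar_prod[of _ n]) auto
  qed
  finally show "(C *\<^sub>v x) \<bullet> (C *\<^sub>v x) \<le> (\<Sum>i<m. row C i \<bullet> row C i) * (x \<bullet> x)"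
    by (simp add: sum_distrib_right)
qed

section \<open>The largest singular value as an operator bound\<close>

text \<open>Off the spectrum, \<open>\<mu> I - S\<close> has an inverse \<open>T\<close>, and
  \<open>K\<close> is a bound for \<open>T\<close> applied to the image of \<open>x\<close>.\<close>

lemma non_eigenvalue_bounded_below:
  fixes S :: "real mat"
  assumes S: "S \<in> carrier_mat n n" and "\<not> eigenvalue S \<mu>"
  shows "\<exists>K\<ge>0. \<forall>x\<in>carrier_vec n. x \<bullet> x \<le> K * ((\<mu> \<cdot>\<^sub>v x - S *\<^sub>v x) \<bullet> (\<mu> \<cdot>\<^sub>v x - S *\<^sub>v x))"
proof -
  define M where "M = \<mu> \<cdot>\<^sub>m 1\<^sub>m n - S"
  have M: "M \<in> carrier_mat n n" using S by (simp add: M_def minus_carrier_mat)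
  have Mx: "M *\<^sub>v x = \<mu> \<cdot>\<^sub>v x - S *\<^sub>v x" if x: "x \<in> carrier_vec n" for x
  proof -
    have "\<mu> \<cdot>\<^sub>m 1\<^sub>m n *\<^sub>v x = \<mu> \<cdot>\<^sub>v x"
      using x by (intro eq_vecI) (auto simp: scalar_prod_left_unit)
    then show ?thesis
      unfolding M_def using S x by (subst minus_mult_distrib_mat_vec[of _ n n]) auto
  qed
  have "det M \<noteq> 0"
  proof
    assume "det M = 0"
    then obtain v where v: "v \<in> carrier_vec n" "v \<noteq> 0\<^sub>v n" "M *\<^sub>v v = 0\<^sub>v n"
      using det_0_iff_vec_prod_zero[OF M] by auto
    have "S *\<^sub>v v = \<mu> \<cdot>\<^sub>v v"
    proof (rule eq_vecI)
      fix i assume i: "i < dim_vec (\<mu> \<cdot>\<^sub>v v)"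
      have "(\<mu> \<cdot>\<^sub>v v - S *\<^sub>v v) $ i = 0"
        unfolding Mx[OF v(1), symmetric] v(3) using v(1) i by simp
      then show "(S *\<^sub>v v) $ i = (\<mu> \<cdot>\<^sub>v v) $ i" using v S i by simp
    qed (use S v in simp)
    then have "eigenvalue S \<mu>"
      using v S unfolding eigenvalue_def eigenvector_def by auto
    then show False using assms by simp
  qed
  \<comment> \<open>The inverse comes from membership in the units of the matrix ring;
    \<open>()\<close> fills the extension slot of the ring record.\<close>
  from det_non_zero_imp_unit[OF M this, of "()"]
  obtain T where T: "T \<in> carrier_mat n n" and TM: "T * M = 1\<^sub>m n"
    unfolding Units_def ring_mat_def by auto
  obtain K where K: "K \<ge> 0" "\<And>x. x \<in> carrier_vec n \<Longrightarrow> (T *\<^sub>v x) \<bullet> (T *\<^sub>v x) \<le> K * (x \<bullet> x)"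
    using mult_mat_vec_bounded[OF T] by blast
  have "x \<bullet> x \<le> K * ((M *\<^sub>v x) \<bullet> (M *\<^sub>v x))" if x: "x \<in> carrier_vec n" for x
    using K(2)[of "M *\<^sub>v x"] assoc_mult_mat_vec[OF T M x] M x by (simp add: TM)
  then show ?thesis using K(1) Mx by (intro exI[of _ K]) auto
qed

text \<open>The eigenvalue is \<open>\<lambda> = sup {\<parallel>B x\<parallel>\<^sup>2 | \<parallel>x\<parallel> = 1}\<close>. No compactness is needed: \<open>\<lambda> I - B\<^sup>T B\<close> is
  positive semidefinite, so \<open>\<parallel>(\<lambda> I - B\<^sup>T B) x\<parallel>\<^sup>2 \<le> (\<lambda> + 1) \<langle>x, (\<lambda> I - B\<^sup>T B) x\<rangle>\<close>; were it invertible, the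
  right-hand side would be bounded away from 0 on the unit sphere.\<close>

lemma gram_eigenvalue_bound:
  fixes B :: "real mat"
  assumes B: "B \<in> carrier_mat m n" and n: "0 < n"
  shows "\<exists>\<mu>. eigenvalue (transpose_mat B * B) \<mu> \<and>
           (\<forall>x\<in>carrier_vec n. (B *\<^sub>v x) \<bullet> (B *\<^sub>v x) \<le> \<mu> * (x \<bullet> x))"
proof -
  define S where "S = transpose_mat B * B"
  have S: "S \<in> carrier_mat n n" using B by (simp add: S_def)
  have SB: "x \<bullet> (S *\<^sub>v x) = (B *\<^sub>v x) \<bullet> (B *\<^sub>v x)" if "x \<in> carrier_vec n" for x
    unfolding S_def using scalar_prod_mult_mat_vec_self[OF B that] by simp
  have Ssym: "x \<bullet> (S *\<^sub>v y) = y \<bullet> (S *\<^sub>v x)" if x: "x \<in> carrier_vec n" and y: "y \<in> carrier_vec n" for x y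
  proof -
    have "transpose_mat S = S" using B by (simp add: S_def transpose_mult[of _ n m _ n])
    then show ?thesis
      using transpose_vec_mult_scalar[OF S y x] S x y
      by (metis comm_scalar_prod mult_mat_vec_carrier)
  qed
  define V where "V = (\<lambda>x. (B *\<^sub>v x) \<bullet> (B *\<^sub>v x)) ` {x \<in> carrier_vec n. x \<bullet> x = 1}"
  define \<mu> where "\<mu> = Sup V"
  obtain K0 where K0: "\<And>x. x \<in> carrier_vec n \<Longrightarrow> (B *\<^sub>v x) \<bullet> (B *\<^sub>v x) \<le> K0 * (x \<bullet> x)"
    using mult_mat_vec_bounded[OF B] by blast
  have bdd: "bdd_above V"
    unfolding V_def by (rule bdd_aboveI[of _ K0]) (use K0 in fastforce)
  \<comment> \<open>The first unit vector exists because \<open>0 < n\<close>; it shows that the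
    supremum is over a nonempty set.\<close>
  have "unit_vec n 0 \<bullet> unit_vec n 0 = (1::real)" using n by simp
  then have ne: "(B *\<^sub>v unit_vec n 0) \<bullet> (B *\<^sub>v unit_vec n 0) \<in> V" by (auto simp: V_def)
  have \<mu>0: "0 \<le> \<mu>"
    unfolding \<mu>_def using cSup_upper[OF ne bdd] scalar_prod_self_nonneg by (rule order_trans[rotated])
  have bound: "(B *\<^sub>v x) \<bullet> (B *\<^sub>v x) \<le> \<mu> * (x \<bullet> x)" if x: "x \<in> carrier_vec n" for x
  proof (cases "x = 0\<^sub>v n")
    case True
    then show ?thesis using K0[OF x] by simp
  next
    case False
    define r where "r = sqrt (x \<bullet> x)"
    have r: "r > 0" "r * r = x \<bullet> x"
      using scalar_prod_self_pos[OF x False] by (auto simp: r_def)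
    define y where "y = (1 / r) \<cdot>\<^sub>v x"
    have y: "y \<in> carrier_vec n" using x by (simp add: y_def)
    have "y \<bullet> y = 1" using x r by (simp add: y_def flip: r(2))
    moreover have "(B *\<^sub>v y) \<bullet> (B *\<^sub>v y) = (B *\<^sub>v x) \<bullet> (B *\<^sub>v x) / (x \<bullet> x)"
      using B x by (simp add: y_def mult_mat_vec[OF B x] flip: r(2))
    ultimately have "(B *\<^sub>v x) \<bullet> (B *\<^sub>v x) / (x \<bullet> x) \<in> V" using y unfolding V_def by force
    then have "(B *\<^sub>v x) \<bullet> (B *\<^sub>v x) / (x \<bullet> x) \<le> \<mu>" unfolding \<mu>_def by (rule cSup_upper[OF _ bdd])
    then show ?thesis using scalar_prod_self_pos[OF x False] by (simp add: field_simps)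
  qed
  have "eigenvalue S \<mu>"
  proof (rule ccontr)
    assume "\<not> eigenvalue S \<mu>"
    from non_eigenvalue_bounded_below[OF S this] obtain K where K: "K \<ge> 0"
      "\<And>x. x \<in> carrier_vec n \<Longrightarrow> x \<bullet> x \<le> K * ((\<mu> \<cdot>\<^sub>v x - S *\<^sub>v x) \<bullet> (\<mu> \<cdot>\<^sub>v x - S *\<^sub>v x))"
      by blast
    \<comment> \<open>Let \<open>Q v = \<mu> (v \<bullet> v) - v \<bullet> S v\<close>, which is
      nonnegative by \<open>bound\<close>, and \<open>y = \<mu> x - S x\<close>. A gradient step of
      length \<open>t\<close> gives \<open>0 \<le> Q (x - t y) = Q x - 2 t (y \<bullet> y) +
      t\<^sup>2 Q y\<close>. Since \<open>Q y \<le> (\<mu> + 1) (y \<bullet> y)\<close>, this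
      \<open>t\<close> yields \<open>t (y \<bullet> y) \<le> Q x\<close>. The summand 1 keeps
      \<open>t\<close> defined when \<mu> = 0.\<close>
    define t where "t = 1 / (\<mu> + 1)"
    have t: "t > 0" "t * (\<mu> + 1) = 1" using \<mu>0 by (auto simp: t_def)
    have key: "t \<le> K * (\<mu> - (B *\<^sub>v x) \<bullet> (B *\<^sub>v x))" if x: "x \<in> carrier_vec n" and x1: "x \<bullet> x = 1" for x
    proof -
      define y where "y = \<mu> \<cdot>\<^sub>v x - S *\<^sub>v x"
      have y: "y \<in> carrier_vec n" using x S by (simp add: y_def)
      have yy: "y \<bullet> y = \<mu> * (x \<bullet> y) - y \<bullet> (S *\<^sub>v x)"
      proof -
        have "y \<bullet> y = y \<bullet> (\<mu> \<cdot>\<^sub>v x) - y \<bullet> (S *\<^sub>v x)"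
          by (subst (2) y_def, rule scalar_prod_minus_distrib[of _ n]) (use x y S in auto)
        then show ?thesis using x y comm_scalar_prod[OF x y] by simp
      qed
      define z where "z = x - t \<cdot>\<^sub>v y"
      have z: "z \<in> carrier_vec n" using x y by (simp add: z_def)
      have zv: "z \<bullet> v = x \<bullet> v - t * (y \<bullet> v)" if "v \<in> carrier_vec n" for v
        unfolding z_def using x y that by (subst minus_scalar_prod_distrib[of _ n]) auto
      have vz: "v \<bullet> z = v \<bullet> x - t * (v \<bullet> y)" if "v \<in> carrier_vec n" for v
        unfolding z_def using x y that by (subst scalar_prod_minus_distrib[of _ n]) auto
      have Sz: "S *\<^sub>v z = S *\<^sub>v x - t \<cdot>\<^sub>v (S *\<^sub>v y)"
        unfolding z_def using x y S by (subst mult_minus_distrib_mat_vec[of _ n n]) (auto simp: mult_mat_vec)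
      have vSz: "v \<bullet> (S *\<^sub>v z) = v \<bullet> (S *\<^sub>v x) - t * (v \<bullet> (S *\<^sub>v y))" if "v \<in> carrier_vec n" for v
        unfolding Sz using x y S that by (subst scalar_prod_minus_distrib[of _ n]) auto
      have "0 \<le> \<mu> * (z \<bullet> z) - z \<bullet> (S *\<^sub>v z)" using bound[OF z] SB[OF z] by simp
      also have "z \<bullet> z = 1 - 2 * t * (x \<bullet> y) + t * t * (y \<bullet> y)"
        using zv[OF z] vz[OF x] vz[OF y] comm_scalar_prod[OF x y] x1 by (simp add: algebra_simps)
      also have "z \<bullet> (S *\<^sub>v z) = x \<bullet> (S *\<^sub>v x) - 2 * t * (y \<bullet> (S *\<^sub>v x)) + t * t * (y \<bullet> (S *\<^sub>v y))"
        using zv[of "S *\<^sub>v z"] S z vSz[OF x] vSz[OF y] Ssym[OF x y] by (simp add: algebra_simps)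
      finally have "0 \<le> (\<mu> - x \<bullet> (S *\<^sub>v x)) - 2 * t * (y \<bullet> y) + t * t * (\<mu> * (y \<bullet> y) - y \<bullet> (S *\<^sub>v y))"
        by (simp add: yy algebra_simps)
      also have "\<dots> \<le> (\<mu> - x \<bullet> (S *\<^sub>v x)) - 2 * t * (y \<bullet> y) + t * t * ((\<mu> + 1) * (y \<bullet> y))"
        using SB[OF y] scalar_prod_self_nonneg[of "B *\<^sub>v y"] scalar_prod_self_nonneg[of y] t(1)
        by (intro add_left_mono mult_left_mono) (auto simp: algebra_simps)
      also have "t * t * ((\<mu> + 1) * (y \<bullet> y)) = (t * (\<mu> + 1)) * (t * (y \<bullet> y))" by simp
      finally have "t * (y \<bullet> y) \<le> \<mu> - (B *\<^sub>v x) \<bullet> (B *\<^sub>v x)" using SB[OF x] t(2) by simp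
      then have "K * (t * (y \<bullet> y)) \<le> K * (\<mu> - (B *\<^sub>v x) \<bullet> (B *\<^sub>v x))" using K(1) by (rule mult_left_mono)
      moreover have "t * 1 \<le> t * (K * (y \<bullet> y))"
        using K(2)[OF x] x1 t(1) unfolding y_def by (intro mult_left_mono) auto
      ultimately show ?thesis by (simp add: mult_ac)
    qed
    \<comment> \<open>At the first unit vector, \<open>K = 0\<close> would give
      \<open>t \<le> 0\<close>. With \<open>K\<close> positive, \<open>key\<close> keeps all of
      \<open>V\<close> below \<open>\<mu> - t / K\<close>, contradicting that \<mu> is its
      supremum.\<close>
    have "K \<noteq> 0" using key[of "unit_vec n 0"] n t by auto
    then have K0: "K > 0" using K(1) by simp
    have "\<mu> \<le> \<mu> - t / K"
    proof (subst (1) \<mu>_def, rule cSup_least)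
      show "V \<noteq> {}" using ne by auto
    next
      fix q assume "q \<in> V"
      then obtain x where "x \<in> carrier_vec n" "x \<bullet> x = 1" "q = (B *\<^sub>v x) \<bullet> (B *\<^sub>v x)"
        by (auto simp: V_def)
      with key[of x] show "q \<le> \<mu> - t / K" using K0 by (simp add: field_simps)
    qed
    then show False using t K0 by (simp add: field_simps)
  qed
  then show ?thesis using bound unfolding S_def by blast
qed

text \<open>The eigenvalue \<mu> from \<open>gram_eigenvalue_bound\<close> serves as
  \<open>c\<close>: its root lies in the finite set whose maximum is below 1, and testing a unit
  vector shows that \<mu> is nonnegative.\<close>

lemma largest_singular_value_less_one:
  assumes B: "B \<in> carrier_mat m n" and n: "0 < n" and less: "largest_singular_value B < 1"
  shows "\<exists>c. 0 \<le> c \<and> c < 1 \<and> (\<forall>x\<in>carrier_vec n. (B *\<^sub>v x) \<bullet> (B *\<^sub>v x) \<le> c * (x \<bullet> x))"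
proof -
  obtain \<mu> where \<mu>: "eigenvalue (transpose_mat B * B) \<mu>"
    "\<And>x. x \<in> carrier_vec n \<Longrightarrow> (B *\<^sub>v x) \<bullet> (B *\<^sub>v x) \<le> \<mu> * (x \<bullet> x)"
    using gram_eigenvalue_bound[OF B n] by blast
  have "transpose_mat B * B \<in> carrier_mat n n" using B by simp
  from card_finite_spectrum(1)[OF this]
  have "sqrt \<mu> \<le> largest_singular_value B"
    unfolding largest_singular_value_def using \<mu>(1) by (intro Max_ge) (auto simp: spectrum_def)
  then have "\<mu> < 1" using less by (smt (verit) real_sqrt_ge_one)
  moreover have "0 \<le> \<mu>"
    using \<mu>(2)[of "unit_vec n 0"] scalar_prod_self_nonneg[of "B *\<^sub>v unit_vec n 0"] n by simp
  ultimately show ?thesis using \<mu>(2) by blast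
qed

section \<open>Orthonormal matrices and the unfoldings of a core\<close>

text \<open>Bessel's inequality: \<open>w\<close> is the orthogonal projection of \<open>x\<close>
  onto the row space, with \<open>w \<bullet> x = w \<bullet> w = y \<bullet> y\<close>, so the
  squared norm of \<open>x - w\<close> is the gap between the two sides.\<close>

lemma orthonormal_rows_contract:
  fixes B :: "real mat"
  assumes B: "B \<in> carrier_mat m n" and BB: "B * transpose_mat B = 1\<^sub>m m" and x: "x \<in> carrier_vec n"
  shows "(B *\<^sub>v x) \<bullet> (B *\<^sub>v x) \<le> x \<bullet> x"
proof -
  define y where "y = B *\<^sub>v x"
  define w where "w = transpose_mat B *\<^sub>v y"
  have y: "y \<in> carrier_vec m" and w: "w \<in> carrier_vec n" using B x by (auto simp: y_def w_def)
  have wx: "w \<bullet> x = y \<bullet> y"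
    unfolding w_def using transpose_vec_mult_scalar[OF B x y] by (simp add: y_def)
  have ww: "w \<bullet> w = y \<bullet> y"
    using scalar_prod_mult_mat_vec_self[of "transpose_mat B" n m y] B y BB by (simp add: w_def)
  have "0 \<le> (x - w) \<bullet> (x - w)" by (rule scalar_prod_self_nonneg)
  also have "\<dots> = x \<bullet> x - 2 * (w \<bullet> x) + w \<bullet> w"
    using x w comm_scalar_prod[OF x w]
    by (simp add: minus_scalar_prod_distrib[of _ n] scalar_prod_minus_distrib[of _ n])
  finally show ?thesis using wx ww by (simp add: y_def)
qed

text \<open>The bijection is \<open>k = a + p * l\<close>, the merged index with its first component
  varying fastest. It turns sums over rows or columns of an unfolding into double sums over core
  indices.\<close>

lemma sum_merged_index:
  fixes f :: "nat \<Rightarrow> nat \<Rightarrow> real"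
  shows "(\<Sum>k<p * q. f (k mod p) (k div p)) = (\<Sum>a<p. \<Sum>l<q. f a l)"
proof (cases "p = 0")
  case False
  have *: "a + p * l < p * q" if "a < p" "l < q" for a l
  proof -
    have "a + p * l < p * Suc l" using that by simp
    also have "\<dots> \<le> p * q" using that by (intro mult_le_mono2) simp
    finally show ?thesis .
  qed
  have "k div p < q" if "k < p * q" for k
    using that by (simp add: less_mult_imp_div_less mult.commute)
  then show ?thesis
    unfolding sum.cartesian_product using False *
    by (intro sum.reindex_bij_witness[of _ "\<lambda>(a, l). a + p * l" "\<lambda>k. (k mod p, k div p)"]) auto
qed simp

text \<open>Stated for an arbitrary core, so that it serves both the isometric cores and the
  \<open>N\<close>-th core.\<close>

lemma left_unfolding_mult_norm:
  "(left_unfolding p q s Y *\<^sub>v vec s z) \<bullet> (left_unfolding p q s Y *\<^sub>v vec s z)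
     = (\<Sum>a<p. \<Sum>l<q. (\<Sum>r<s. Y [a, l, r] * z r)\<^sup>2)"
proof -
  have "(left_unfolding p q s Y *\<^sub>v vec s z) \<bullet> (left_unfolding p q s Y *\<^sub>v vec s z)
      = (\<Sum>k<p * q. (\<Sum>r<s. Y [k mod p, k div p, r] * z r)\<^sup>2)"
    by (simp add: scalar_prod_self_eq_sum left_unfolding_def scalar_prod_def atLeast0LessThan)
  then show ?thesis
    using sum_merged_index[of "\<lambda>a l. (\<Sum>r<s. Y [a, l, r] * z r)\<^sup>2" p q] by simp
qed

lemma left_orthonormal_isometry:
  assumes "left_orthonormal p q s Y"
  shows "(\<Sum>a<p. \<Sum>l<q. (\<Sum>r<s. Y [a, l, r] * z r)\<^sup>2) = (\<Sum>r<s. (z r)\<^sup>2)"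
proof -
  have "left_unfolding p q s Y \<in> carrier_mat (p * q) s" by (simp add: left_unfolding_def)
  from scalar_prod_mult_mat_vec_self[OF this, of "vec s z"] show ?thesis
    using assms unfolding left_orthonormal_def
    by (simp add: left_unfolding_mult_norm scalar_prod_self_vec)
qed

text \<open>Flattening \<open>z\<close> in the column order of the right unfolding turns the
  contraction into a matrix-vector product, to which Bessel's inequality applies.\<close>

lemma right_orthonormal_contraction:
  assumes "right_orthonormal p q s Y"
  shows "(\<Sum>a<p. (\<Sum>l<q. \<Sum>r<s. Y [a, l, r] * z l r)\<^sup>2) \<le> (\<Sum>l<q. \<Sum>r<s. (z l r)\<^sup>2)"
proof -
  let ?B = "right_unfolding p q s Y" and ?x = "vec (q * s) (\<lambda>k. z (k mod q) (k div q))"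
  have B: "?B \<in> carrier_mat p (q * s)" by (simp add: right_unfolding_def)
  have "(?B *\<^sub>v ?x) $ a = (\<Sum>l<q. \<Sum>r<s. Y [a, l, r] * z l r)" if "a < p" for a
    using that sum_merged_index[of "\<lambda>l r. Y [a, l, r] * z l r" q s]
    by (simp add: right_unfolding_def scalar_prod_def atLeast0LessThan)
  then have "(?B *\<^sub>v ?x) \<bullet> (?B *\<^sub>v ?x) = (\<Sum>a<p. (\<Sum>l<q. \<Sum>r<s. Y [a, l, r] * z l r)\<^sup>2)"
    using B by (simp add: scalar_prod_self_eq_sum)
  moreover have "?x \<bullet> ?x = (\<Sum>l<q. \<Sum>r<s. (z l r)\<^sup>2)"
    using sum_merged_index[of "\<lambda>l r. (z l r)\<^sup>2" q s] by (simp add: scalar_prod_self_eq_sum)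
  ultimately show ?thesis
    using orthonormal_rows_contract[OF B, of ?x] assms unfolding right_orthonormal_def by simp
qed

section \<open>Sums over multi-indices and tensor trains as nested contractions\<close>

lemma multi_indices_Nil: "multi_indices [] = {[]}"
  by (auto simp: multi_indices_def)

lemma multi_indices_Cons:
  "multi_indices (L # Ls) = (\<lambda>(l, ls). l # ls) ` ({..<L} \<times> multi_indices Ls)"
proof
  show "multi_indices (L # Ls) \<subseteq> (\<lambda>(l, ls). l # ls) ` ({..<L} \<times> multi_indices Ls)"
  proof
    fix xs assume "xs \<in> multi_indices (L # Ls)"
    then have xs: "length xs = Suc (length Ls)" "\<And>k. k < Suc (length Ls) \<Longrightarrow> xs ! k < (L # Ls) ! k"
      by (auto simp: multi_indices_def)
    then obtain l ls where "xs = l # ls" by (metis length_Suc_conv)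
    with xs(1) xs(2)[of 0] xs(2)[of "Suc _"]
    show "xs \<in> (\<lambda>(l, ls). l # ls) ` ({..<L} \<times> multi_indices Ls)"
      by (force simp: multi_indices_def)
  qed
qed (auto simp: multi_indices_def nth_Cons split: nat.split)

lemma sum_multi_indices_Cons:
  fixes f :: "nat list \<Rightarrow> real"
  shows "(\<Sum>xs\<in>multi_indices (L # Ls). f xs) = (\<Sum>l<L. \<Sum>ls\<in>multi_indices Ls. f (l # ls))"
  unfolding multi_indices_Cons sum.cartesian_product
  by (subst sum.reindex) (auto simp: inj_on_def case_prod_unfold)

lemma multi_indices_append:
  assumes "xs \<in> multi_indices Ks" and "ys \<in> multi_indices Ls"
  shows "xs @ ys \<in> multi_indices (Ks @ Ls)"
  using assms by (auto simp: multi_indices_def nth_append)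

text \<open>\<open>tt_chain R G n ls y r\<close> contracts the cores \<open>n + 1, \<dots>, n + length ls\<close>, evaluated at the mode
  indices \<open>ls\<close>, with bond index \<open>r\<close> on the left and the vector \<open>y\<close> on the right.\<close>

fun tt_chain ::
  "(nat \<Rightarrow> nat) \<Rightarrow> (nat \<Rightarrow> tensor) \<Rightarrow> nat \<Rightarrow> nat list \<Rightarrow> (nat \<Rightarrow> real) \<Rightarrow> nat \<Rightarrow> real" where
  "tt_chain R G n [] y r = y r"
| "tt_chain R G n (l # ls) y r =
     (\<Sum>s<R (Suc n). G (Suc n) [r, l, s] * tt_chain R G (Suc n) ls y s)"

text \<open>Cutting the train at a bond: the contracted right part becomes the boundary vector of
  the left part.\<close>

lemma tt_chain_append:
  "tt_chain R G n (ls @ ks) y r = tt_chain R G n ls (tt_chain R G (n + length ls) ks y) r"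
  by (induction ls arbitrary: n r) auto

text \<open>Linearity in the boundary vector; it moves the sum over input indices past the left half
  of the train.\<close>

lemma tt_chain_sum:
  "tt_chain R G n ls (\<lambda>s. \<Sum>i\<in>I. f i s * c i) r = (\<Sum>i\<in>I. tt_chain R G n ls (f i) r * c i)"
proof (induction ls arbitrary: n r)
  case (Cons l ls)
  show ?case
    by (simp add: Cons.IH sum_distrib_left sum_distrib_right mult.assoc) (rule sum.swap)
qed simp

text \<open>Distributivity, one core at a time. The list \<open>r # rs\<close> holds all bond
  indices; the all-ones boundary vector means that the last one is summed too.\<close>

lemma tt_chain_eq_sum:
  "tt_chain R G n ls (\<lambda>_. 1) r =
     (\<Sum>rs\<in>multi_indices (map R [Suc n..<Suc (n + length ls)]).
        \<Prod>i<length ls. G (Suc (n + i)) [(r # rs) ! i, ls ! i, (r # rs) ! Suc i])"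
proof (induction ls arbitrary: n r)
  case (Cons l ls)
  have "[Suc n..<Suc (n + length (l # ls))] = Suc n # [Suc (Suc n)..<Suc (Suc n + length ls)]"
    by (subst upt_conv_Cons) auto
  then show ?case
    by (simp add: Cons.IH sum_multi_indices_Cons prod.lessThan_Suc_shift sum_distrib_left
             del: prod.lessThan_Suc upt_Suc)
qed (simp add: multi_indices_Nil)

text \<open>Since \<open>R 0 = 1\<close>, the leftmost bond index is always 0; shifting the product
  by one passes from cores numbered from 1 to list positions.\<close>

lemma tt_decomposition_eq_chain:
  assumes "tt_decomposition Ls R G Y" and "ls \<in> multi_indices Ls"
  shows "Y ls = tt_chain R G 0 ls (\<lambda>_. 1) 0"
proof -
  have len: "length ls = length Ls" using assms(2) by (simp add: multi_indices_def)
  have R0: "R 0 = 1" using assms(1) by (simp add: tt_decomposition_def Let_def)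
  have "[0..<Suc (length Ls)] = 0 # [Suc 0..<Suc (length Ls)]"
    by (subst upt_conv_Cons) auto
  moreover have "Y ls = (\<Sum>rs\<in>multi_indices (map R [0..<Suc (length Ls)]).
      \<Prod>n=1..length Ls. G n [rs ! (n - 1), ls ! (n - 1), rs ! n])"
    using assms unfolding tt_decomposition_def Let_def by blast
  moreover have "(\<Prod>n=1..length Ls. G n [rs ! (n - 1), ls ! (n - 1), rs ! n])
      = (\<Prod>i<length Ls. G (Suc i) [rs ! i, ls ! i, rs ! Suc i])" for rs
    by (intro prod.reindex_bij_witness[of _ Suc "\<lambda>n. n - 1"]) auto
  ultimately have "Y ls = (\<Sum>rs\<in>multi_indices (map R (0 # [Suc 0..<Suc (length Ls)])).
      \<Prod>i<length Ls. G (Suc i) [rs ! i, ls ! i, rs ! Suc i])"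
    by (simp only:)
  then show ?thesis
    by (simp add: tt_chain_eq_sum len R0 sum_multi_indices_Cons del: upt_Suc)
qed

section \<open>Norm bounds for the two halves of the train\<close>

text \<open>Peeling off the leftmost core costs a factor \<open>c 0\<close>, and induction handles
  the others. Separate constants let isometric cores and the \<open>N\<close>-th core share one
  induction.\<close>

lemma tt_chain_left_bound:
  assumes "\<And>k z. k < length Ls \<Longrightarrow>
      (\<Sum>a<R (n + k). \<Sum>l<Ls ! k. (\<Sum>r<R (Suc (n + k)). G (Suc (n + k)) [a, l, r] * z r)\<^sup>2)
        \<le> c k * (\<Sum>r<R (Suc (n + k)). (z r)\<^sup>2)"
    and "\<And>k. k < length Ls \<Longrightarrow> 0 \<le> c k"
  shows "(\<Sum>ls\<in>multi_indices Ls. \<Sum>a<R n. (tt_chain R G n ls y a)\<^sup>2)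
           \<le> (\<Prod>k<length Ls. c k) * (\<Sum>r<R (n + length Ls). (y r)\<^sup>2)"
  using assms
proof (induction Ls arbitrary: n c)
  case (Cons L Ls)
  let ?T = "\<lambda>ls. tt_chain R G (Suc n) ls y"
  have "(\<Sum>ls\<in>multi_indices (L # Ls). \<Sum>a<R n. (tt_chain R G n ls y a)\<^sup>2)
      = (\<Sum>ls\<in>multi_indices Ls. \<Sum>l<L. \<Sum>a<R n. (\<Sum>r<R (Suc n). G (Suc n) [a, l, r] * ?T ls r)\<^sup>2)"
    by (simp add: sum_multi_indices_Cons) (rule sum.swap)
  also have "\<dots> = (\<Sum>ls\<in>multi_indices Ls. \<Sum>a<R n. \<Sum>l<L. (\<Sum>r<R (Suc n). G (Suc n) [a, l, r] * ?T ls r)\<^sup>2)"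
    by (intro sum.cong refl sum.swap)
  also have "\<dots> \<le> (\<Sum>ls\<in>multi_indices Ls. c 0 * (\<Sum>r<R (Suc n). (?T ls r)\<^sup>2))"
    using Cons.prems(1)[of 0] by (intro sum_mono) simp
  also have "\<dots> = c 0 * (\<Sum>ls\<in>multi_indices Ls. \<Sum>r<R (Suc n). (?T ls r)\<^sup>2)"
    by (simp add: sum_distrib_left)
  also have "\<dots> \<le> c 0 * ((\<Prod>k<length Ls. c (Suc k)) * (\<Sum>r<R (Suc n + length Ls). (y r)\<^sup>2))"
  proof (intro mult_left_mono Cons.IH)
    fix k z assume "k < length Ls"
    then show "(\<Sum>a<R (Suc n + k). \<Sum>l<Ls ! k.
          (\<Sum>r<R (Suc (Suc n + k)). G (Suc (Suc n + k)) [a, l, r] * z r)\<^sup>2)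
        \<le> c (Suc k) * (\<Sum>r<R (Suc (Suc n + k)). (z r)\<^sup>2)"
      using Cons.prems(1)[of "Suc k" z] by simp
  qed (use Cons.prems(2) in auto)
  finally show ?case
    by (simp add: prod.lessThan_Suc_shift mult.assoc del: prod.lessThan_Suc)
qed (simp add: multi_indices_Nil)

text \<open>The first core acts on \<open>z\<close>, the contractions of the remaining cores with
  the slices \<open>X (l # ls)\<close>. Induction bounds each slice, hence \<open>X\<close> is
  generalized, and the squared norms of the slices add up to that of \<open>X\<close>.\<close>

lemma tt_chain_right_bound:
  assumes "\<And>k z. k < length Ls \<Longrightarrow>
      (\<Sum>a<R (n + k). (\<Sum>l<Ls ! k. \<Sum>r<R (Suc (n + k)). G (Suc (n + k)) [a, l, r] * z l r)\<^sup>2)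
        \<le> (\<Sum>l<Ls ! k. \<Sum>r<R (Suc (n + k)). (z l r)\<^sup>2)"
  shows "(\<Sum>a<R n. (\<Sum>ls\<in>multi_indices Ls. tt_chain R G n ls y a * X ls)\<^sup>2)
           \<le> (\<Sum>r<R (n + length Ls). (y r)\<^sup>2) * (\<Sum>ls\<in>multi_indices Ls. (X ls)\<^sup>2)"
  using assms
proof (induction Ls arbitrary: n X)
  case (Cons L Ls)
  define z where "z = (\<lambda>l r. \<Sum>ls\<in>multi_indices Ls. tt_chain R G (Suc n) ls y r * X (l # ls))"
  have "(\<Sum>ls\<in>multi_indices (L # Ls). tt_chain R G n ls y a * X ls)
      = (\<Sum>l<L. \<Sum>r<R (Suc n). G (Suc n) [a, l, r] * z l r)" for a
    unfolding z_def sum_multi_indices_Cons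
    by (intro sum.cong refl, simp add: sum_distrib_left sum_distrib_right mult.assoc) (rule sum.swap)
  then have "(\<Sum>a<R n. (\<Sum>ls\<in>multi_indices (L # Ls). tt_chain R G n ls y a * X ls)\<^sup>2)
      \<le> (\<Sum>l<L. \<Sum>r<R (Suc n). (z l r)\<^sup>2)"
    using Cons.prems[of 0 z] by simp
  also have "\<dots> \<le> (\<Sum>l<L. (\<Sum>r<R (Suc n + length Ls). (y r)\<^sup>2) * (\<Sum>ls\<in>multi_indices Ls. (X (l # ls))\<^sup>2))"
    unfolding z_def
  proof (intro sum_mono Cons.IH)
    fix k and z :: "nat \<Rightarrow> nat \<Rightarrow> real" assume "k < length Ls"
    then show "(\<Sum>a<R (Suc n + k).
          (\<Sum>l<Ls ! k. \<Sum>r<R (Suc (Suc n + k)). G (Suc (Suc n + k)) [a, l, r] * z l r)\<^sup>2)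
        \<le> (\<Sum>l<Ls ! k. \<Sum>r<R (Suc (Suc n + k)). (z l r)\<^sup>2)"
      using Cons.prems[of "Suc k" z] by simp
  qed
  finally show ?case by (simp add: sum_multi_indices_Cons sum_distrib_left)
qed (simp add: multi_indices_Nil power_mult_distrib sum_distrib_right)

section \<open>The linear system and its stability\<close>

text \<open>The permuted index order puts all output indices before all input indices. Cutting at
  bond \<open>N\<close> thus lets the last \<open>N\<close> cores absorb \<open>X\<close> before the
  first \<open>N\<close> cores act.\<close>

lemma einstein_product_eq_tt_chain:
  assumes "tt_decomposition (Js @ Js) R G (permuted_tensor Js A)" and js: "js \<in> multi_indices Js"
  shows "einstein_product Js A X js =
           tt_chain R G 0 js
             (\<lambda>r. \<Sum>is\<in>multi_indices Js. tt_chain R G (length Js) is (\<lambda>_. 1) r * X is) 0"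
proof -
  have len: "length js = length Js" using js by (simp add: multi_indices_def)
  have "A (splice js is) = tt_chain R G 0 js (tt_chain R G (length Js) is (\<lambda>_. 1)) 0"
    if "is \<in> multi_indices Js" for "is"
  proof -
    have mem: "js @ is \<in> multi_indices (Js @ Js)" using js that by (rule multi_indices_append)
    then have "A (splice js is) = permuted_tensor Js A (js @ is)"
      by (simp add: permuted_tensor_def flip: len)
    also have "\<dots> = tt_chain R G 0 js (tt_chain R G (length Js) is (\<lambda>_. 1)) 0"
      using tt_decomposition_eq_chain[OF assms(1) mem] by (simp add: tt_chain_append len)
    finally show ?thesis .
  qed
  then show ?thesis using js by (simp add: einstein_product_def tt_chain_sum)
qed

text \<open>Squared norms decay at least like \<open>c ^ t\<close>; the square root is taken only in
  the limit.\<close>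

lemma mlti_asymptotically_stable_contraction:
  assumes "0 \<le> c" and "c < 1"
    and "\<And>X. (\<Sum>js\<in>multi_indices Js. (einstein_product Js A X js)\<^sup>2)
               \<le> c * (\<Sum>js\<in>multi_indices Js. (X js)\<^sup>2)"
  shows "mlti_asymptotically_stable Js A"
  unfolding mlti_asymptotically_stable_def
proof (intro allI impI)
  fix X assume "X 0 \<in> tensors Js \<and> (\<forall>t. X (Suc t) = einstein_product Js A (X t))"
  then have X: "X (Suc t) = einstein_product Js A (X t)" for t by simp
  define a where "a t = (\<Sum>js\<in>multi_indices Js. (X t js)\<^sup>2)" for t
  have a_nonneg: "0 \<le> a t" for t by (simp add: a_def sum_nonneg)
  have le: "a t \<le> c ^ t * a 0" for t
  proof (induction t)
    case (Suc t)
    have "a (Suc t) \<le> c * a t" unfolding a_def X by (rule assms(3))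
    also have "\<dots> \<le> c * (c ^ t * a 0)" using Suc assms(1) by (rule mult_left_mono)
    finally show ?case by (simp add: mult.assoc)
  qed simp
  have "(\<lambda>t. c ^ t * a 0) \<longlonglongrightarrow> 0"
    using assms(1,2) by (intro tendsto_mult_left_zero LIMSEQ_realpow_zero)
  then have "a \<longlonglongrightarrow> 0"
    by (rule tendsto_sandwich[OF _ _ tendsto_const, rotated 2])
       (auto intro!: always_eventually le simp: a_nonneg)
  from tendsto_real_sqrt[OF this] show "(\<lambda>t. frobenius_norm Js (X t)) \<longlonglongrightarrow> 0"
    by (simp add: frobenius_norm_def a_def)
qed

theorem corollary5p4:
  fixes N :: nat and Js :: "nat list" and A :: tensor
    and R :: "nat \<Rightarrow> nat" and G :: "nat \<Rightarrow> tensor"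
  assumes "1 \<le> N" and "length Js = N" and "\<forall>J\<in>set Js. 1 \<le> J"
    and "A \<in> tensors (splice Js Js)"
    and "tt_decomposition (Js @ Js) R G (permuted_tensor Js A)"
    and "\<forall>n\<in>{1..N - 1}. left_orthonormal (R (n - 1)) ((Js @ Js) ! (n - 1)) (R n) (G n)"
    and "\<forall>n\<in>{N + 1..2 * N}. right_orthonormal (R (n - 1)) ((Js @ Js) ! (n - 1)) (R n) (G n)"
    and "largest_singular_value (left_unfolding (R (N - 1)) (Js ! (N - 1)) (R N) (G N)) < 1"
  shows "mlti_asymptotically_stable Js A"
proof -
  have ranks: "R 0 = 1" "R (N + N) = 1" "0 < R N"
    using assms(2,5) by (auto simp: tt_decomposition_def Let_def Suc_le_eq)
  let ?B = "left_unfolding (R (N - 1)) (Js ! (N - 1)) (R N) (G N)"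
  have "?B \<in> carrier_mat (R (N - 1) * Js ! (N - 1)) (R N)" by (simp add: left_unfolding_def)
  from largest_singular_value_less_one[OF this ranks(3) assms(8)]
  obtain c where c: "0 \<le> c" "c < 1"
    and contraction: "\<forall>x\<in>carrier_vec (R N). (?B *\<^sub>v x) \<bullet> (?B *\<^sub>v x) \<le> c * (x \<bullet> x)"
    by blast
  have middle: "(\<Sum>a<R (N - 1). \<Sum>l<Js ! (N - 1). (\<Sum>r<R N. G N [a, l, r] * z r)\<^sup>2)
      \<le> c * (\<Sum>r<R N. (z r)\<^sup>2)" for z
    using bspec[OF contraction vec_carrier, of z]
    unfolding left_unfolding_mult_norm scalar_prod_self_vec .
  show ?thesis
  proof (rule mlti_asymptotically_stable_contraction[OF c])
    fix X
    define y where "y = (\<lambda>r. \<Sum>is\<in>multi_indices Js. tt_chain R G N is (\<lambda>_. 1) r * X is)"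
    \<comment> \<open>Position \<open>k\<close> belongs to core \<open>k + 1\<close>, so only
      \<open>k = N - 1\<close> gets the factor \<open>c\<close>; all earlier cores are isometries
      with factor 1.\<close>
    define d where "d = (\<lambda>k. if k = N - 1 then c else 1)"
    have "(\<Prod>k<N. d k) = c" using assms(1) by (cases N) (simp_all add: d_def)
    moreover have "(\<Sum>js\<in>multi_indices Js. \<Sum>a<R 0. (tt_chain R G 0 js y a)\<^sup>2)
        \<le> (\<Prod>k<length Js. d k) * (\<Sum>r<R (0 + length Js). (y r)\<^sup>2)"
    proof (rule tt_chain_left_bound)
      fix k and z :: "nat \<Rightarrow> real" assume k: "k < length Js"
      show "(\<Sum>a<R (0 + k). \<Sum>l<Js ! k. (\<Sum>r<R (Suc (0 + k)). G (Suc (0 + k)) [a, l, r] * z r)\<^sup>2)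
          \<le> d k * (\<Sum>r<R (Suc (0 + k)). (z r)\<^sup>2)"
      proof (cases "k = N - 1")
        case True
        then show ?thesis using middle[of z] assms(1) by (simp add: d_def)
      next
        case False
        then have "left_orthonormal (R k) (Js ! k) (R (Suc k)) (G (Suc k))"
          using k assms(2) bspec[OF assms(6), of "Suc k"] by (simp add: nth_append)
        then show ?thesis using False by (simp add: d_def left_orthonormal_isometry)
      qed
    qed (use c in \<open>simp add: d_def\<close>)
    ultimately have "(\<Sum>js\<in>multi_indices Js. (tt_chain R G 0 js y 0)\<^sup>2) \<le> c * (\<Sum>r<R N. (y r)\<^sup>2)"
      by (simp add: assms(2) ranks(1))
    \<comment> \<open>The boundary vector is all ones on bond \<open>2 * N\<close>; since that rank
      is 1, its squared norm is 1.\<close>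
    also have "(\<Sum>r<R N. (y r)\<^sup>2)
        \<le> (\<Sum>r<R (N + length Js). 1\<^sup>2) * (\<Sum>is\<in>multi_indices Js. (X is)\<^sup>2)"
      unfolding y_def
    proof (rule tt_chain_right_bound)
      fix k and z :: "nat \<Rightarrow> nat \<Rightarrow> real" assume k: "k < length Js"
      \<comment> \<open>Core \<open>N + k + 1\<close> sits at position \<open>N + k\<close> of
        \<open>Js @ Js\<close>, hence has mode size \<open>Js ! k\<close>.\<close>
      then have "right_orthonormal (R (N + k)) (Js ! k) (R (Suc (N + k))) (G (Suc (N + k)))"
        using assms(2) bspec[OF assms(7), of "Suc (N + k)"] by (simp add: nth_append)
      then show "(\<Sum>a<R (N + k). (\<Sum>l<Js ! k. \<Sum>r<R (Suc (N + k)). G (Suc (N + k)) [a, l, r] * z l r)\<^sup>2)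
          \<le> (\<Sum>l<Js ! k. \<Sum>r<R (Suc (N + k)). (z l r)\<^sup>2)"
        by (rule right_orthonormal_contraction)
    qed
    finally show "(\<Sum>js\<in>multi_indices Js. (einstein_product Js A X js)\<^sup>2)
        \<le> c * (\<Sum>js\<in>multi_indices Js. (X js)\<^sup>2)"
      using c(1) assms(2) ranks(2)
      by (simp add: einstein_product_eq_tt_chain[OF assms(5)] y_def mult_left_mono)
  qed
qed

end
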